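(* The following two claims are equivalent: (i) There is an algorithm which, given Boolean conjunctive queries $\psi_s,\psi_b$ over a common signature, decides whether $\psi_s\le_\forall\psi_b$ (i.e. $QCP^{bag}_{CQ}$ is decidable). (ii) There is an algorithm which, given a Boolean conjunctive query $\psi_s$ and a Boolean union of conjunctive queries $\Psi_b$ over a common signature, decides whether $\psi_s\le_\forall\Psi_b$.
   Context: All structures are finite relational structures over a signature that may contain constant symbols; the vertex set $\mathcal V(D)$ contains the interpretations of the constants. All queries are Boolean, with all variables implicitly existentially quantified. For a conjunctive query (CQ) $\phi$ and a structure $D$, $\phi\odot D$ denotes the number of maps $h:var(\phi)\to\mathcal V(D)$ such that every atom of $\phi$, after replacing each variable $v$ by $h(v)$ (and constants by their interpretations), is a fact of $D$ (bag-set semantics: $D$ is an ordinary set of facts). A union of conjunctive queries (UCQ) $\Phi=\bigvee_{j=1}^{J}\phi_j$ has pairwise variable-disjoint disjuncts and $\Phi\odot D:=\sum_{j=1}^J\phi_j\odot D$. $\Psi_s\le_\forall\Psi_b$ means $\Psi_s\odot D\le\Psi_b\odot D$ for every structure $D$. *)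

theory Defs
  imports Main "HOL-Library.Nat_Bijection" "HOL-Library.FuncSet"
begin

datatype recf = Z | S | Proj nat | Cn recf "recf list" | Pr recf recf | Mn recf

inductive eval :: "recf \<Rightarrow> nat list \<Rightarrow> nat \<Rightarrow> bool" where
  eval_Z: "eval Z xs 0"
| eval_S: "eval S (x # xs) (Suc x)"
| eval_Proj: "n < length xs \<Longrightarrow> eval (Proj n) xs (xs ! n)"
| eval_Cn: "list_all2 (\<lambda>g z. eval g xs z) gs zs \<Longrightarrow> eval f zs y \<Longrightarrow> eval (Cn f gs) xs y"
| eval_Pr0: "eval f xs y \<Longrightarrow> eval (Pr f g) (0 # xs) y"
| eval_PrS: "eval (Pr f g) (x # xs) z \<Longrightarrow> eval g (z # x # xs) y \<Longrightarrow> eval (Pr f g) (Suc x # xs) y"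
| eval_Mn: "eval f (y # xs) 0 \<Longrightarrow> (\<forall>x<y. \<exists>z. eval f (x # xs) z \<and> z \<noteq> 0) \<Longrightarrow> eval (Mn f) xs y"

definition decidable_on :: "'x set \<Rightarrow> ('x \<Rightarrow> nat) \<Rightarrow> ('x \<Rightarrow> bool) \<Rightarrow> bool" where
  "decidable_on W enc P \<longleftrightarrow> (\<exists>f. \<forall>x\<in>W. eval f [enc x] (if P x then 1 else 0))"

text \<open>Terms: variables and constant symbols (both named by naturals).
  A relation symbol is identified by its name together with its arity
  (the length of the argument list), so any collection of atoms is over a
  well-formed common signature.\<close>
datatype trm = Var nat | Cst nat

type_synonym atom = "nat \<times> trm list"
type_synonym cq = "atom list"
type_synonym ucq = "cq list"

text \<open>A finite structure: a finite set of facts over the domain nat, together with an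
  interpretation of the constant symbols.\<close>
type_synonym fact = "nat \<times> nat list"

definition vars :: "cq \<Rightarrow> nat set" where
  "vars \<phi> = {v. \<exists>a\<in>set \<phi>. Var v \<in> set (snd a)}"

definition vertices :: "fact set \<Rightarrow> (nat \<Rightarrow> nat) \<Rightarrow> nat set" where
  "vertices F c = {x. \<exists>f\<in>F. x \<in> set (snd f)} \<union> range c"

fun tval :: "(nat \<Rightarrow> nat) \<Rightarrow> (nat \<Rightarrow> nat) \<Rightarrow> trm \<Rightarrow> nat" where
  "tval c h (Var v) = h v"
| "tval c h (Cst k) = c k"

definition cq_count :: "cq \<Rightarrow> fact set \<Rightarrow> (nat \<Rightarrow> nat) \<Rightarrow> nat" where
  "cq_count \<phi> F c = card {h. h \<in> vars \<phi> \<rightarrow>\<^sub>E vertices F c \<and>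
       (\<forall>(R, ts)\<in>set \<phi>. (R, map (tval c h) ts) \<in> F)}"

definition ucq_count :: "ucq \<Rightarrow> fact set \<Rightarrow> (nat \<Rightarrow> nat) \<Rightarrow> nat" where
  "ucq_count \<Phi> F c = (\<Sum>\<phi>\<leftarrow>\<Phi>. cq_count \<phi> F c)"

definition bag_le :: "ucq \<Rightarrow> ucq \<Rightarrow> bool" where
  "bag_le \<Psi>s \<Psi>b \<longleftrightarrow> (\<forall>F c. finite F \<longrightarrow> ucq_count \<Psi>s F c \<le> ucq_count \<Psi>b F c)"

fun enc_trm :: "trm \<Rightarrow> nat" where
  "enc_trm (Var n) = 2 * n"
| "enc_trm (Cst n) = 2 * n + 1"

definition enc_atom :: "atom \<Rightarrow> nat" where
  "enc_atom a = prod_encode (fst a, list_encode (map enc_trm (snd a)))"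

definition enc_cq :: "cq \<Rightarrow> nat" where
  "enc_cq \<phi> = list_encode (map enc_atom \<phi>)"

definition enc_ucq :: "ucq \<Rightarrow> nat" where
  "enc_ucq \<Phi> = list_encode (map enc_cq \<Phi>)"

definition QCP_CQ :: "cq \<times> cq \<Rightarrow> bool" where
  "QCP_CQ p = bag_le [fst p] [snd p]"

definition enc_cq_cq :: "cq \<times> cq \<Rightarrow> nat" where
  "enc_cq_cq p = prod_encode (enc_cq (fst p), enc_cq (snd p))"

definition QCP_CQ_UCQ :: "cq \<times> ucq \<Rightarrow> bool" where
  "QCP_CQ_UCQ p = bag_le [fst p] (snd p)"

definition enc_cq_ucq :: "cq \<times> ucq \<Rightarrow> nat" where
  "enc_cq_ucq p = prod_encode (enc_cq (fst p), enc_ucq (snd p))"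

end

theory Submission
  imports Defs
begin

text \<open>
  A union \<open>\<phi>\<^sub>1 \<or> \<dots> \<or> \<phi>\<^sub>J\<close> is simulated by a single conjunctive query, a product in which only one
  factor is switched on. Every relation gets an additional first column for a tag, and two fresh
  constants top and bottom serve as tags. Query \<open>\<phi>\<^sub>j\<close> is tagged by a variable \<open>y\<^sub>j\<close>, and its constants
  \<open>k\<close> become variables \<open>v\<close> guarded by an atom \<open>K\<^sub>k(y\<^sub>j, v)\<close>. The small query consists of \<open>\<psi>\<^sub>s\<close> tagged
  by top and of ground atoms which guarantee that each \<open>\<phi>\<^sub>j\<close> tagged by bottom is satisfied by sending
  all variables to bottom, and that the selector relation contains the tuples with top at one
  position \<open>j \<ge> 1\<close> and bottom elsewhere. The product query selects a tuple \<open>(y\<^sub>0, \<dots>, y\<^sub>J)\<close>; in the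
  minimal structure its count is exactly \<open>\<Sum>j. \<phi>\<^sub>j\<close>, and it is at least that sum whenever the ground
  atoms hold and top differs from bottom. If top and bottom coincide, the sum may exceed the
  product; for this case \<open>\<phi>\<^sub>0 = \<psi>\<^sub>s\<close> is an additional factor that is never switched on, and which alone
  then contributes at least \<open>\<psi>\<^sub>s\<close>.

  The translation is computable, as unary computable functions on Cantor codes are closed
  under composition, pairing and iteration, and this suffices for all list operations.
\<close>

subsection \<open>Computable functions on codes\<close>

definition computable :: "(nat \<Rightarrow> nat) \<Rightarrow> bool" where
  "computable f \<longleftrightarrow> (\<exists>r. \<forall>x. eval r [x] (f x))"

abbreviation pair :: "nat \<Rightarrow> nat \<Rightarrow> nat" where
  "pair m n \<equiv> prod_encode (m, n)"

abbreviation pi1 :: "nat \<Rightarrow> nat" where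
  "pi1 n \<equiv> fst (prod_decode n)"

abbreviation pi2 :: "nat \<Rightarrow> nat" where
  "pi2 n \<equiv> snd (prod_decode n)"

text \<open>The first argument is meant as a parameter, so that \<open>g x\<close> can be iterated
  or mapped over a list as a unary function.\<close>

definition computable2 :: "(nat \<Rightarrow> nat \<Rightarrow> nat) \<Rightarrow> bool" where
  "computable2 g \<longleftrightarrow> computable (\<lambda>p. g (pi1 p) (pi2 p))"

section \<open>Arithmetic and Cantor pairing by recursive functions\<close>

lemma eval_Cn1: "eval g xs z \<Longrightarrow> eval f [z] y \<Longrightarrow> eval (Cn f [g]) xs y"
  by (rule eval_Cn[where zs = "[z]"]) auto

lemma eval_Cn2:
  "eval g xs z \<Longrightarrow> eval g' xs z' \<Longrightarrow> eval f [z, z'] y \<Longrightarrow> eval (Cn f [g, g']) xs y"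
  by (rule eval_Cn[where zs = "[z, z']"]) auto

lemma eval_Proj0: "eval (Proj 0) (x # xs) x"
  using eval_Proj[of 0 "x # xs"] by simp

lemma eval_Proj1: "eval (Proj (Suc 0)) (x # y # xs) y"
  using eval_Proj[of 1 "x # y # xs"] by simp

definition r_add :: recf where "r_add = Pr (Proj 0) (Cn S [Proj 0])"
definition r_pred :: recf where "r_pred = Pr Z (Proj (Suc 0))"
text \<open>Truncated subtraction takes the subtrahend first, because primitive recursion runs on
  the first argument.\<close>

definition r_sub :: recf where "r_sub = Pr (Proj 0) (Cn r_pred [Proj 0])"
definition r_triangle :: recf where
  "r_triangle = Pr Z (Cn r_add [Proj 0, Cn S [Proj (Suc 0)]])"

lemma eval_add: "eval r_add [x, y] (x + y)"
  unfolding r_add_def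
  by (induction x) (auto intro!: eval_Pr0 eval_PrS eval_Proj0 eval_Cn1 eval_S)

lemma eval_pred: "eval r_pred [x] (x - 1)"
  unfolding r_pred_def
  by (induction x) (auto intro: eval_Pr0 eval_PrS eval_Proj1 eval_Z)

lemma eval_sub: "eval r_sub [y, x] (x - y)"
  unfolding r_sub_def
proof (induction y)
  case 0
  show ?case by (auto intro!: eval_Pr0 eval_Proj0)
next
  case (Suc y)
  show ?case
    using eval_PrS[OF Suc, OF eval_Cn1, OF eval_Proj0 eval_pred] by simp
qed

lemma eval_triangle: "eval r_triangle [x] (triangle x)"
  unfolding r_triangle_def
proof (induction x)
  case 0
  show ?case by (auto intro!: eval_Pr0 eval_Z)
next
  case (Suc x)
  show ?case
    using eval_PrS[OF Suc, OF eval_Cn2, OF eval_Proj0 eval_Cn1, OF eval_Proj1 eval_S eval_add]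
    by simp
qed

definition r_pair :: recf where
  "r_pair = Cn r_add [Cn r_triangle [r_add], Proj 0]"

lemma eval_pair: "eval r_pair [m, n] (pair m n)"
  unfolding r_pair_def prod_encode_def
  using eval_Cn2[OF eval_Cn1[OF eval_add eval_triangle] eval_Proj0 eval_add, of m n]
  by simp

text \<open>Row \<open>s\<close> of Cantor's enumeration is the least one with \<open>z < triangle (Suc s)\<close>.\<close>

definition r_row :: recf where
  "r_row = Mn (Cn r_sub [Cn r_triangle [Cn S [Proj 0]], Cn S [Proj (Suc 0)]])"

lemma triangle_mono: "x \<le> y \<Longrightarrow> triangle x \<le> triangle y"
  by (rule lift_Suc_mono_le[of triangle]) auto

text \<open>Write \<open>z = triangle (m + n) + m\<close>. Row \<open>m + n\<close> passes the test
  since \<open>m \<le> m + n\<close>; an earlier row \<open>s\<close> fails it since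
  \<open>triangle (Suc s) \<le> triangle (m + n) \<le> z\<close>.\<close>

lemma eval_row: "eval r_row [z] (pi1 z + pi2 z)"
proof -
  obtain m n where mn: "prod_decode z = (m, n)" by fastforce
  then have z: "z = triangle (m + n) + m"
    using prod_decode_inverse[of z] by (simp add: prod_encode_def)
  let ?f = "Cn r_sub [Cn r_triangle [Cn S [Proj 0]], Cn S [Proj (Suc 0)]]"
  have ev: "eval ?f [s, z] (Suc z - triangle (Suc s))" for s
    by (auto intro!: eval_Cn2 eval_Cn1 eval_Proj0 eval_Proj1 eval_S eval_triangle eval_sub
        simp del: triangle_Suc)
  have "eval ?f [m + n, z] 0"
    using ev[of "m + n"] z by simp
  moreover have "Suc z - triangle (Suc s) \<noteq> 0" if "s < m + n" for s
    using triangle_mono[of "Suc s" "m + n"] that z by simp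
  ultimately have "eval r_row [z] (m + n)"
    unfolding r_row_def using ev by (blast intro: eval_Mn)
  then show ?thesis by (simp add: mn)
qed

lemma computable_pi1: "computable pi1"
proof -
  \<comment> \<open>The first component is the offset of \<open>z\<close> inside its row.\<close>
  have "eval (Cn r_sub [Cn r_triangle [r_row], Proj 0]) [z] (pi1 z)" for z
  proof -
    obtain m n where mn: "prod_decode z = (m, n)" by fastforce
    then have z: "z = triangle (m + n) + m"
      using prod_decode_inverse[of z] by (simp add: prod_encode_def)
    show ?thesis
      using eval_Cn2[OF eval_Cn1[OF eval_row eval_triangle] eval_Proj0 eval_sub, of z]
      by (simp add: mn) (simp add: z)
  qed
  then show ?thesis unfolding computable_def by blast
qed

lemma computable_pi2: "computable pi2"
proof -
  obtain r where r: "\<And>z. eval r [z] (pi1 z)"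
    using computable_pi1 unfolding computable_def by blast
  have "eval (Cn r_sub [r, r_row]) [z] (pi2 z)" for z
    using eval_Cn2[OF r eval_row eval_sub, of z] by simp
  then show ?thesis unfolding computable_def by blast
qed

section \<open>Closure properties of computable functions\<close>

lemma computable_compose:
  assumes "computable g" "computable f"
  shows "computable (\<lambda>x. g (f x))"
  using assms unfolding computable_def by (meson eval_Cn1)

lemma computable_id: "computable (\<lambda>x. x)"
  unfolding computable_def using eval_Proj0 by blast

lemma computable_Suc: "computable f \<Longrightarrow> computable (\<lambda>x. Suc (f x))"
  using computable_compose[of Suc f] eval_S unfolding computable_def by blast

lemma computable_const: "computable (\<lambda>x. k)"
proof (induction k)
  case 0
  show ?case unfolding computable_def using eval_Z by blast
qed (rule computable_Suc)

lemma computable_pair: "computable f \<Longrightarrow> computable g \<Longrightarrow> computable (\<lambda>x. pair (f x) (g x))"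
  unfolding computable_def by (meson eval_Cn2 eval_pair)

lemmas computable_fst = computable_compose[OF computable_pi1]
lemmas computable_snd = computable_compose[OF computable_pi2]

text \<open>The state carries the parameter \<open>x\<close> along with the iterated value, which
  makes each round a unary function of the accumulator alone.\<close>

lemma computable_iter:
  assumes "computable2 g" "computable n" "computable f"
  shows "computable (\<lambda>x. (g x ^^ n x) (f x))"
proof -
  let ?step = "\<lambda>p. pair (pi1 p) (g (pi1 p) (pi2 p))"
  let ?init = "\<lambda>x. pair x (f x)"
  have "computable ?step" "computable ?init"
    using assms unfolding computable2_def
    by (auto intro!: computable_pair computable_fst computable_id)
  then obtain rs ri where rs: "\<And>x. eval rs [x] (?step x)" and ri: "\<And>x. eval ri [x] (?init x)"
    unfolding computable_def by blast
  obtain rn where rn: "\<And>x. eval rn [x] (n x)"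
    using assms unfolding computable_def by blast
  have ev: "eval (Pr ri (Cn rs [Proj 0])) [k, x] ((?step ^^ k) (?init x))" for k x
    by (induction k) (auto intro!: eval_Pr0 ri eval_PrS eval_Cn1 eval_Proj0 rs)
  have "(?step ^^ k) (?init x) = pair x ((g x ^^ k) (f x))" for k x
    by (induction k) auto
  with ev have "eval (Cn (Pr ri (Cn rs [Proj 0])) [rn, Proj 0]) [x] (pair x ((g x ^^ n x) (f x)))" for x
    by (metis eval_Cn2 rn eval_Proj0)
  then have "computable (\<lambda>x. pair x ((g x ^^ n x) (f x)))"
    unfolding computable_def by blast
  from computable_snd[OF this] show ?thesis by simp
qed

lemma computable2_compose:
  assumes "computable2 g" "computable f" "computable h"
  shows "computable (\<lambda>x. g (f x) (h x))"
  using computable_compose[OF assms(1)[unfolded computable2_def] computable_pair[OF assms(2,3)]]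
  by simp

lemma computable2_compose_left:
  assumes "computable2 g" "computable f"
  shows "computable2 (\<lambda>x. g (f x))"
  unfolding computable2_def
  by (intro computable2_compose[OF assms(1)] computable_compose[OF assms(2)] computable_pi1 computable_pi2)

text \<open>Iterating the constant function with value \<open>h x\<close> from \<open>g x\<close>
  yields \<open>g x\<close> after zero rounds and \<open>h x\<close> after any positive number of
  rounds.\<close>

lemma computable_if:
  assumes "computable f" "computable g" "computable h"
  shows "computable (\<lambda>x. if f x = 0 then g x else h x)"
proof -
  have "computable2 (\<lambda>x y. h x)"
    unfolding computable2_def by (intro computable_compose[OF assms(3)] computable_pi1)
  from computable_iter[OF this assms(1,2)]
  have "computable (\<lambda>x. ((\<lambda>y. h x) ^^ f x) (g x))" .
  moreover have "((\<lambda>y. h x) ^^ k) z = (if k = 0 then z else h x)" for x z k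
    by (cases k) auto
  ultimately show ?thesis by simp
qed

lemma computable_add:
  assumes "computable f" "computable g"
  shows "computable (\<lambda>x. f x + g x)"
  using assms eval_add unfolding computable_def by (meson eval_Cn2)

lemma computable_diff:
  assumes "computable f" "computable g"
  shows "computable (\<lambda>x. f x - g x)"
  using assms eval_sub unfolding computable_def by (meson eval_Cn2)

lemma computable_if_eq:
  assumes "computable a" "computable b" "computable g" "computable h"
  shows "computable (\<lambda>x. if a x = b x then g x else h x)"
proof -
  \<comment> \<open>Two numbers agree iff both truncated differences vanish.\<close>
  have "computable (\<lambda>x. if (a x - b x) + (b x - a x) = 0 then g x else h x)"
    by (intro computable_if computable_add computable_diff assms)
  moreover have "(if (m - n) + (n - m) = 0 then u else v) = (if m = n then u else v)"
    for m n u v :: nat by auto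
  ultimately show ?thesis by simp
qed

lemma computable_double: "computable f \<Longrightarrow> computable (\<lambda>x. 2 * f x)"
  unfolding mult_2 by (rule computable_add)

lemma computable_mod2:
  assumes "computable f"
  shows "computable (\<lambda>x. f x mod 2)"
proof -
  \<comment> \<open>Parity is obtained by flipping a bit \<open>f x\<close> times.\<close>
  have "computable2 (\<lambda>x y. if y = 0 then 1 else 0)"
    unfolding computable2_def by (intro computable_if computable_const computable_pi2)
  from computable_iter[OF this assms computable_const[of 0]]
  have "computable (\<lambda>x. ((\<lambda>y::nat. if y = 0 then 1 else 0) ^^ f x) 0)" .
  moreover have "((\<lambda>y::nat. if y = 0 then 1 else 0) ^^ k) 0 = k mod 2" for k
    by (induction k) (auto simp: mod_Suc)
  ultimately show ?thesis by simp
qed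

section \<open>List operations on codes\<close>

abbreviation cons :: "nat \<Rightarrow> nat \<Rightarrow> nat" where
  "cons x l \<equiv> Suc (pair x l)"

text \<open>The state pairs the accumulator with the code of the remaining list; 0 codes the empty
  list, and any other code is \<open>cons\<close> of head and tail.\<close>

lemma computable_foldl:
  assumes g: "computable (\<lambda>p. g (pi1 p) (pi1 (pi2 p)) (pi2 (pi2 p)))"
    and a: "computable a" and l: "computable l"
  shows "computable (\<lambda>x. foldl (g x) (a x) (list_decode (l x)))"
proof -
  define step where "step = (\<lambda>x s. if pi2 s = 0 then s
    else pair (g x (pi1 s) (pi1 (pi2 s - 1))) (pi2 (pi2 s - 1)))"
  have g': "computable (\<lambda>y. g (u y) (v y) (w y))"
    if "computable u" "computable v" "computable w" for u v w
    using computable_compose[OF g computable_pair[OF that(1) computable_pair[OF that(2,3)]]]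
    by simp
  have "computable2 step"
    unfolding step_def computable2_def
    by (intro computable_if computable_pair g' computable_diff computable_const computable_fst
        computable_snd computable_id)
  \<comment> \<open>The code of a list is at least its length, so the code itself serves as the
    number of rounds; once the list is used up, \<open>step\<close> leaves the state alone.\<close>
  from computable_iter[OF this l computable_pair[OF a l]]
  have "computable (\<lambda>x. (step x ^^ l x) (pair (a x) (l x)))" .
  moreover have steps: "(step x ^^ n) (pair b (list_encode ys)) = pair (foldl (g x) b ys) 0"
    if "length ys \<le> n" for x n b ys
    using that
  proof (induction n arbitrary: b ys)
    case (Suc n)
    show ?case
    proof (cases ys)
      case Nil
      then have "step x (pair b (list_encode ys)) = pair b (list_encode ys)"
        by (simp add: step_def)
      then show ?thesis
        using Suc.IH[of ys b] Nil by (simp add: funpow_Suc_right del: funpow.simps)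
    next
      case (Cons z zs)
      then have "step x (pair b (list_encode ys)) = pair (g x b z) (list_encode zs)"
        by (simp add: step_def)
      then show ?thesis
        using Suc.IH[of zs "g x b z"] Suc.prems Cons
        by (simp add: funpow_Suc_right del: funpow.simps)
    qed
  qed auto
  have len: "length ys \<le> list_encode ys" for ys
    by (induction ys) (auto intro: le_trans le_prod_encode_2)
  have "(step x ^^ l x) (pair (a x) (l x)) = pair (foldl (g x) (a x) (list_decode (l x))) 0" for x
    using steps[of "list_decode (l x)" "l x" x "a x"] len[of "list_decode (l x)"] by simp
  ultimately have "computable (\<lambda>x. pair (foldl (g x) (a x) (list_decode (l x))) 0)"
    by simp
  from computable_fst[OF this] show ?thesis by simp
qed

text \<open>Consing during a left fold reverses the list, which is why mapping and appending reverse
  their input first.\<close>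

lemma list_encode_rev_onto:
  "foldl (\<lambda>acc y. cons (g y) acc) (list_encode ys) xs = list_encode (rev (map g xs) @ ys)"
proof (induction xs arbitrary: ys)
  case (Cons x xs)
  show ?case using Cons[of "g x # ys"] by simp
qed simp

lemma computable_rev:
  assumes "computable l"
  shows "computable (\<lambda>x. list_encode (rev (list_decode (l x))))"
proof -
  have "computable (\<lambda>x. foldl (\<lambda>acc y. cons y acc) 0 (list_decode (l x)))"
    by (intro computable_foldl computable_Suc computable_pair computable_fst computable_snd
        computable_id computable_const assms)
  then show ?thesis using list_encode_rev_onto[of "\<lambda>y. y" "[]"] by simp
qed

lemma computable_map:
  assumes "computable2 g" "computable l"
  shows "computable (\<lambda>x. list_encode (map (g x) (list_decode (l x))))"
proof -
  have "computable (\<lambda>x. foldl (\<lambda>acc y. cons (g x y) acc) 0 (list_decode (list_encode (rev (list_decode (l x))))))"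
    by (intro computable_foldl computable_Suc computable_pair computable_fst computable_snd
        computable_id computable_const computable_rev assms(2) computable2_compose[OF assms(1)])
  then show ?thesis
    using list_encode_rev_onto[of "g _" "[]"] by (simp add: rev_map)
qed

lemma computable_append:
  assumes "computable k" "computable l"
  shows "computable (\<lambda>x. list_encode (list_decode (k x) @ list_decode (l x)))"
proof -
  have "computable (\<lambda>x. foldl (\<lambda>acc y. cons y acc) (l x) (list_decode (list_encode (rev (list_decode (k x))))))"
    by (intro computable_foldl computable_Suc computable_pair computable_fst computable_snd
        computable_id computable_rev assms)
  then show ?thesis
    using list_encode_rev_onto[of "\<lambda>y. y" "list_decode (l _)"] by simp
qed

lemma computable_concat:
  assumes "computable l"
  shows "computable (\<lambda>x. list_encode (concat (map list_decode (list_decode (l x)))))"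
proof -
  have "computable (\<lambda>x. foldl (\<lambda>acc y. list_encode (list_decode acc @ list_decode y)) 0 (list_decode (l x)))"
    by (intro computable_foldl computable_append computable_fst computable_snd
        computable_id computable_const assms)
  moreover have "foldl (\<lambda>acc y. list_encode (list_decode acc @ list_decode y)) (list_encode ys) xs
      = list_encode (ys @ concat (map list_decode xs))" for ys xs
    by (induction xs arbitrary: ys) auto
  note this[of "[]"]
  ultimately show ?thesis by simp
qed

lemma computable_length:
  assumes "computable l"
  shows "computable (\<lambda>x. length (list_decode (l x)))"
proof -
  have "computable (\<lambda>x. foldl (\<lambda>acc y. Suc acc) 0 (list_decode (l x)))"
    by (intro computable_foldl computable_Suc computable_fst computable_snd
        computable_id computable_const assms)
  moreover have "foldl (\<lambda>acc y. Suc acc) n xs = n + length xs" for n and xs :: "nat list"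
    by (induction xs arbitrary: n) auto
  ultimately show ?thesis by simp
qed

lemma computable_upt:
  assumes "computable n"
  shows "computable (\<lambda>x. list_encode [0..<n x])"
proof -
  \<comment> \<open>A counter builds the list in descending order; it is reversed at the
    end.\<close>
  let ?step = "\<lambda>s. pair (Suc (pi1 s)) (cons (pi1 s) (pi2 s))"
  have "computable2 (\<lambda>x. ?step)"
    unfolding computable2_def
    by (intro computable_Suc computable_pair computable_fst computable_snd computable_id)
  from computable_iter[OF this assms computable_const[of "pair 0 0"]]
  have "computable (\<lambda>x. (?step ^^ n x) (pair 0 0))" .
  moreover have "(?step ^^ k) (pair 0 0) = pair k (list_encode (rev [0..<k]))" for k
    by (induction k) auto
  ultimately have "computable (\<lambda>x. pair (n x) (list_encode (rev [0..<n x])))"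
    by simp
  from computable_rev[OF computable_snd[OF this]] show ?thesis by simp
qed

text \<open>On nonempty codes, \<open>pi2 (l - 1)\<close> is the tail and \<open>pi1 (l - 1)\<close>
  the head.\<close>

definition nth_code :: "nat \<Rightarrow> nat \<Rightarrow> nat" where
  "nth_code l j = pi1 (((\<lambda>l. pi2 (l - 1)) ^^ j) l - 1)"

lemma nth_code: "j < length xs \<Longrightarrow> nth_code (list_encode xs) j = xs ! j"
  unfolding nth_code_def
proof (induction xs arbitrary: j)
  case (Cons x xs)
  then show ?case
    by (cases j) (simp_all add: funpow_Suc_right del: funpow.simps(2))
qed simp

lemma computable_nth_code:
  assumes "computable l" "computable j"
  shows "computable (\<lambda>x. nth_code (l x) (j x))"
  unfolding nth_code_def
proof (intro computable_fst computable_diff computable_const computable_iter assms)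
  show "computable2 (\<lambda>x l. pi2 (l - 1))"
    unfolding computable2_def
    by (intro computable_snd computable_diff computable_id computable_const)
qed

text \<open>Many-one reduction: \<open>f\<close> acts on the objects, and the computable
  \<open>r\<close> is its effect on their codes.\<close>

lemma decidable_on_reduce:
  assumes dec: "decidable_on W enc P" and comp: "computable r"
    and enc: "\<And>x. x \<in> W' \<Longrightarrow> f x \<in> W \<and> enc (f x) = r (enc' x)"
    and P: "\<And>x. x \<in> W' \<Longrightarrow> P (f x) \<longleftrightarrow> P' x"
  shows "decidable_on W' enc' P'"
proof -
  obtain d where d: "\<And>x. x \<in> W \<Longrightarrow> eval d [enc x] (if P x then 1 else 0)"
    using dec unfolding decidable_on_def by blast
  obtain c where c: "\<And>n. eval c [n] (r n)"
    using comp unfolding computable_def by blast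
  have "eval (Cn d [c]) [enc' x] (if P' x then 1 else 0)" if "x \<in> W'" for x
    using eval_Cn1[OF c, of d "enc' x"] d[of "f x"] enc[OF that] P[OF that] by simp
  then show ?thesis unfolding decidable_on_def by blast
qed

subsection \<open>Homomorphisms and the translated queries\<close>

definition models :: "fact set \<Rightarrow> (nat \<Rightarrow> nat) \<Rightarrow> (nat \<Rightarrow> nat) \<Rightarrow> cq \<Rightarrow> bool" where
  "models F c h \<phi> \<longleftrightarrow> (\<forall>(R, ts)\<in>set \<phi>. (R, map (tval c h) ts) \<in> F)"

definition homs :: "cq \<Rightarrow> fact set \<Rightarrow> (nat \<Rightarrow> nat) \<Rightarrow> (nat \<Rightarrow> nat) set" where
  "homs \<phi> F c = {h \<in> extensional (vars \<phi>). models F c h \<phi>}"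

lemma models_append: "models F c h (\<phi> @ \<psi>) \<longleftrightarrow> models F c h \<phi> \<and> models F c h \<psi>"
  unfolding models_def by (simp add: ball_Un)

lemma tval_cong: "(\<And>v. Var v = t \<Longrightarrow> h v = h' v) \<Longrightarrow> tval c h t = tval c h' t"
  by (cases t) auto

lemma models_cong:
  assumes "\<And>v. v \<in> vars \<phi> \<Longrightarrow> h v = h' v"
  shows "models F c h \<phi> \<longleftrightarrow> models F c h' \<phi>"
proof -
  have "map (tval c h) (snd a) = map (tval c h') (snd a)" if "a \<in> set \<phi>" for a
  proof (intro map_cong[OF refl] tval_cong)
    fix t v assume "t \<in> set (snd a)" "Var v = t"
    then have "v \<in> vars \<phi>" using that unfolding vars_def by force
    then show "h v = h' v" by (rule assms)
  qed
  then show ?thesis by (simp add: models_def case_prod_beta del: map_eq_conv)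
qed

text \<open>Every variable of a query occurs in one of its atoms. Hence the vertex bound in
  \<open>cq_count\<close> holds automatically, and \<open>homs\<close> is finite.\<close>

lemma homs_value_in_facts:
  assumes "h \<in> homs \<phi> F c" "v \<in> vars \<phi>"
  shows "h v \<in> (\<Union>f\<in>F. set (snd f))"
proof -
  obtain R ts where a: "(R, ts) \<in> set \<phi>" "Var v \<in> set ts"
    using assms(2) unfolding vars_def by auto
  then have "(R, map (tval c h) ts) \<in> F"
    using assms(1) unfolding homs_def models_def by auto
  moreover have "h v \<in> set (map (tval c h) ts)"
    using a(2) by (force simp: image_iff)
  ultimately show ?thesis by (metis UN_iff snd_conv)
qed

lemma cq_count_eq_card_homs: "cq_count \<phi> F c = card (homs \<phi> F c)"
proof -
  have "{h. h \<in> vars \<phi> \<rightarrow>\<^sub>E vertices F c \<and> (\<forall>(R, ts)\<in>set \<phi>. (R, map (tval c h) ts) \<in> F)}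
      = homs \<phi> F c" (is "?A = _")
  proof
    show "?A \<subseteq> homs \<phi> F c" unfolding homs_def models_def by (auto simp: PiE_def)
    show "homs \<phi> F c \<subseteq> ?A"
    proof
      fix h assume h: "h \<in> homs \<phi> F c"
      then have "h v \<in> vertices F c" if "v \<in> vars \<phi>" for v
        using homs_value_in_facts[OF h that] unfolding vertices_def by blast
      with h show "h \<in> ?A" unfolding homs_def models_def by (auto simp: PiE_def)
    qed
  qed
  then show ?thesis unfolding cq_count_def by simp
qed

lemma finite_vars: "finite (vars \<phi>)"
proof -
  have "vars \<phi> = (\<Union>a\<in>set \<phi>. Var -` set (snd a))"
    unfolding vars_def by auto
  then show ?thesis by (auto intro: finite_vimageI simp: inj_def)
qed

lemma finite_homs: "finite F \<Longrightarrow> finite (homs \<phi> F c)"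
proof (rule finite_subset)
  show "homs \<phi> F c \<subseteq> vars \<phi> \<rightarrow>\<^sub>E (\<Union>f\<in>F. set (snd f))"
  proof
    fix h assume h: "h \<in> homs \<phi> F c"
    then have "h \<in> extensional (vars \<phi>)" unfolding homs_def by simp
    then show "h \<in> vars \<phi> \<rightarrow>\<^sub>E (\<Union>f\<in>F. set (snd f))"
      using homs_value_in_facts[OF h] by (simp add: PiE_def Pi_def)
  qed
  show "finite F \<Longrightarrow> finite (vars \<phi> \<rightarrow>\<^sub>E (\<Union>f\<in>F. set (snd f)))"
    by (intro finite_PiE finite_vars) auto
qed

text \<open>The index keeps homomorphisms of different disjuncts apart even where disjuncts
  coincide, so counts can be compared by injections and surjections.\<close>

lemma ucq_count_eq_card_Sigma:
  assumes "finite F"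
  shows "ucq_count \<Psi> F c = card (SIGMA j:{..<length \<Psi>}. homs (\<Psi> ! j) F c)"
  unfolding ucq_count_def
  by (simp add: sum_list_sum_nth atLeast0LessThan cq_count_eq_card_homs finite_homs[OF assms])

section \<open>The translated queries\<close>

fun relabel :: "trm \<Rightarrow> trm" where
  "relabel (Var v) = Var v"
| "relabel (Cst k) = Cst (Suc (Suc k))"

text \<open>The shift in \<open>relabel\<close> frees the constants 0 and 1 for use as tags.\<close>

abbreviation (input) top_cst :: trm where "top_cst \<equiv> Cst 0"
abbreviation (input) bot_cst :: trm where "bot_cst \<equiv> Cst 1"

text \<open>Relation names are split by parity: \<open>2 * R + 2\<close> is the tagged copy of
  \<open>R\<close>, \<open>2 * k + 1\<close> is the guard of the constant \<open>k\<close>, and 0 is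
  left for the selector relation and a dummy atom.\<close>

definition tag_atoms :: "trm \<Rightarrow> (trm \<Rightarrow> trm) \<Rightarrow> cq \<Rightarrow> cq" where
  "tag_atoms y \<tau> \<phi> = map (\<lambda>(R, ts). (2 * R + 2, y # map \<tau> ts)) \<phi>"

text \<open>Variables get the harmless atom \<open>(0, [])\<close>, so that a query is translated by mapping over
  its list of terms, without filtering.\<close>

fun cst_atom :: "trm \<Rightarrow> (trm \<Rightarrow> trm) \<Rightarrow> trm \<Rightarrow> atom" where
  "cst_atom y \<tau> (Var v) = (0, [])"
| "cst_atom y \<tau> (Cst k) = (2 * k + 1, [y, \<tau> (Cst k)])"

definition terms :: "cq \<Rightarrow> trm list" where
  "terms \<phi> = concat (map snd \<phi>)"

definition tagged :: "trm \<Rightarrow> (trm \<Rightarrow> trm) \<Rightarrow> cq \<Rightarrow> cq" where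
  "tagged y \<tau> \<phi> = tag_atoms y \<tau> \<phi> @ map (cst_atom y \<tau>) (terms \<phi>)"

text \<open>Row \<open>j\<close> switches on the \<open>j\<close>-th query. There is no row for query \<open>0\<close>, which is \<open>\<psi>\<^sub>s\<close> itself.\<close>

definition selectors :: "nat \<Rightarrow> cq" where
  "selectors n = map (\<lambda>j. (0, map (\<lambda>i. if i = j then top_cst else bot_cst) [0..<n])) [1..<n]"

text \<open>The three blocks supply the guard facts for the active factor, an all-bottom solution
  for the inactive factors, and the selector rows.\<close>

definition ground_part :: "cq list \<Rightarrow> cq" where
  "ground_part \<Phi> = map (cst_atom top_cst relabel) (terms (concat \<Phi>))
     @ tagged bot_cst (\<lambda>_. bot_cst) (concat \<Phi>) @ selectors (length \<Phi>)"

definition small_cq :: "cq \<Rightarrow> ucq \<Rightarrow> cq" where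
  "small_cq s \<Psi> = tag_atoms top_cst relabel s @ ground_part (s # \<Psi>)"

definition tag_var :: "nat \<Rightarrow> trm" where
  "tag_var j = Var (prod_encode (j, 0))"

text \<open>The component \<open>j\<close> makes the factors variable-disjoint, and
  \<open>Suc\<close> reserves 0 for the tag. Constants become variables as well, since an inactive
  factor has to send them to bottom.\<close>

definition apart :: "nat \<Rightarrow> trm \<Rightarrow> trm" where
  "apart j t = Var (prod_encode (j, Suc (enc_trm t)))"

definition product_cq :: "cq list \<Rightarrow> cq" where
  "product_cq \<Phi> = (0, map tag_var [0..<length \<Phi>])
     # concat (map (\<lambda>j. tagged (tag_var j) (apart j) (\<Phi> ! j)) [0..<length \<Phi>])"

section \<open>Variables and homomorphisms of the translated queries\<close>

lemma enc_trm_eq_iff: "enc_trm t = enc_trm t' \<longleftrightarrow> t = t'"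
proof (cases t; cases t')
qed (auto, presburger+)

lemma vars_append: "vars (\<phi> @ \<psi>) = vars \<phi> \<union> vars \<psi>"
  unfolding vars_def by auto

lemma vars_tag_relabel: "vars (tag_atoms top_cst relabel s) = vars s"
proof -
  have "Var v = relabel t \<longleftrightarrow> t = Var v" for v t by (cases t) auto
  then have "Var v \<in> set (top_cst # map relabel ts) \<longleftrightarrow> Var v \<in> set ts" for v ts
    by (simp add: image_iff)
  then show ?thesis unfolding vars_def tag_atoms_def by (simp add: case_prod_beta)
qed

text \<open>Without variables, the ground part acts on \<open>small_cq\<close> as a yes-or-no
  condition.\<close>

lemma vars_ground_part: "vars (ground_part \<Phi>) = {}"
proof -
  have cst: "vars (map (cst_atom (Cst a) \<tau>) ts) = {}" if "\<And>k v. \<tau> (Cst k) \<noteq> Var v" for a \<tau> ts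
  proof -
    have "Var v \<notin> set (snd (cst_atom (Cst a) \<tau> t))" for v t
      using that[THEN not_sym] by (cases t) auto
    then show ?thesis unfolding vars_def by simp
  qed
  have "vars (tag_atoms bot_cst (\<lambda>_. bot_cst) \<phi>) = {}" for \<phi>
    unfolding vars_def tag_atoms_def by auto
  moreover have "vars (selectors n) = {}" for n
    unfolding vars_def selectors_def by auto
  ultimately show ?thesis
    unfolding ground_part_def tagged_def vars_append by (simp add: cst)
qed

lemma tval_relabel: "tval c h (relabel t) = tval (\<lambda>k. c (Suc (Suc k))) h t"
  by (cases t) auto

text \<open>The slice of the structure that is visible to a query whose tag has the value
  \<open>u\<close>.\<close>

definition facts_at :: "nat \<Rightarrow> fact set \<Rightarrow> fact set" where
  "facts_at u F = {(R, xs). (2 * R + 2, u # xs) \<in> F}"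

lemma finite_facts_at: "finite F \<Longrightarrow> finite (facts_at u F)"
proof -
  have "facts_at u F = (\<lambda>(R, xs). (2 * R + 2, u # xs)) -` F"
    unfolding facts_at_def by auto
  then show "finite F \<Longrightarrow> ?thesis" by (auto intro!: finite_vimageI simp: inj_def)
qed

text \<open>Ground atoms do not see the valuation, hence the choice of \<open>undefined\<close>.\<close>

lemma homs_append_ground:
  assumes "vars \<gamma> = {}"
  shows "homs (\<phi> @ \<gamma>) F c = (if models F c undefined \<gamma> then homs \<phi> F c else {})"
  using models_cong[of \<gamma> _ undefined F c] assms
  by (auto simp: homs_def vars_append models_append)

text \<open>The tag is the constant top, so the atoms of \<open>s\<close> are evaluated in the slice
  at \<open>c 0\<close>; undoing the shift of \<open>relabel\<close> gives the constants of that
  slice.\<close>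

lemma homs_small_cq:
  "homs (small_cq s \<Psi>) F c = (if models F c undefined (ground_part (s # \<Psi>))
     then homs s (facts_at (c 0) F) (\<lambda>k. c (Suc (Suc k))) else {})"
proof -
  have "homs (tag_atoms top_cst relabel s) F c = homs s (facts_at (c 0) F) (\<lambda>k. c (Suc (Suc k)))"
    unfolding homs_def vars_tag_relabel
    by (auto simp: models_def tag_atoms_def facts_at_def tval_relabel o_def)
  then show ?thesis
    unfolding small_cq_def homs_append_ground[OF vars_ground_part] by simp
qed

lemma models_tagged:
  "models F c h (tagged y \<tau> \<phi>) \<longleftrightarrow>
     (\<forall>(R, ts)\<in>set \<phi>. (2 * R + 2, tval c h y # map (\<lambda>t. tval c h (\<tau> t)) ts) \<in> F) \<and>
     models F c h (map (cst_atom y \<tau>) (terms \<phi>))"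
  unfolding tagged_def models_append by (auto simp: models_def tag_atoms_def o_def)

lemma models_cst_atoms:
  "models F c h (map (cst_atom y \<tau>) ts) \<longleftrightarrow>
     (\<forall>t\<in>set ts. case t of Var v \<Rightarrow> (0, []) \<in> F
        | Cst k \<Rightarrow> (2 * k + 1, [tval c h y, tval c h (\<tau> (Cst k))]) \<in> F)"
proof -
  have "(case cst_atom y \<tau> t of (R, us) \<Rightarrow> (R, map (tval c h) us) \<in> F) \<longleftrightarrow>
     (case t of Var v \<Rightarrow> (0, []) \<in> F
        | Cst k \<Rightarrow> (2 * k + 1, [tval c h y, tval c h (\<tau> (Cst k))]) \<in> F)" for t
    by (cases t) auto
  then show ?thesis unfolding models_def by simp
qed

lemma models_product_cq:
  "models F c h (product_cq \<Phi>) \<longleftrightarrow>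
     (0, map (\<lambda>i. h (prod_encode (i, 0))) [0..<length \<Phi>]) \<in> F \<and>
     (\<forall>i<length \<Phi>. models F c h (tagged (tag_var i) (apart i) (\<Phi> ! i)))"
proof -
  have "models F c h (concat \<phi>s) \<longleftrightarrow> (\<forall>\<phi>\<in>set \<phi>s. models F c h \<phi>)" for \<phi>s
    unfolding models_def by auto
  from this[of "map _ [0..<_]"] show ?thesis
    unfolding product_cq_def by (auto simp: models_def tag_var_def o_def)
qed

lemma models_selectors:
  "models F c h (selectors n) \<longleftrightarrow>
     (\<forall>j. 0 < j \<and> j < n \<longrightarrow> (0, map (\<lambda>i. if i = j then c 0 else c 1) [0..<n]) \<in> F)"
  unfolding models_def selectors_def by (auto simp: o_def if_distrib[of "tval c h"] cong: if_cong)

lemma vars_product_cq: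
  "vars (product_cq \<Phi>) = (\<Union>i<length \<Phi>. insert (prod_encode (i, 0))
     ((\<lambda>t. prod_encode (i, Suc (enc_trm t))) ` set (terms (\<Phi> ! i))))"
proof -
  have cst: "Var v \<in> set (snd (cst_atom y \<tau> t)) \<Longrightarrow> Var v = y \<or> Var v = \<tau> t" for v y \<tau> t
    by (cases t) auto
  have tags: "v \<in> vars (tag_atoms y \<tau> \<phi>) \<longleftrightarrow> \<phi> \<noteq> [] \<and> Var v = y \<or> (\<exists>t\<in>set (terms \<phi>). Var v = \<tau> t)"
    for v y \<tau> \<phi>
    unfolding vars_def tag_atoms_def terms_def
    by (cases \<phi>) (auto simp: case_prod_beta image_iff)
  have csts: "v \<in> vars (map (cst_atom y \<tau>) ts) \<Longrightarrow> Var v = y \<or> (\<exists>t\<in>set ts. Var v = \<tau> t)"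
    for v y \<tau> ts
    unfolding vars_def by (auto dest: cst)
  \<comment> \<open>A query without atoms does not mention its tag. The tag is therefore added on
    both sides here, and the selector atom supplies it in the product.\<close>
  have tagged: "v \<in> vars (tagged y \<tau> \<phi>) \<or> Var v = y
      \<longleftrightarrow> Var v = y \<or> (\<exists>t\<in>set (terms \<phi>). Var v = \<tau> t)" for v y \<tau> \<phi>
    unfolding tagged_def vars_append Un_iff tags using csts[of v y \<tau> "terms \<phi>"] by argo
  have "v \<in> vars (product_cq \<Phi>) \<longleftrightarrow>
      (\<exists>i<length \<Phi>. v \<in> vars (tagged (tag_var i) (apart i) (\<Phi> ! i)) \<or> Var v = tag_var i)" for v
    unfolding product_cq_def vars_def by (auto simp: image_iff)
  then have "v \<in> vars (product_cq \<Phi>) \<longleftrightarrow> (\<exists>i<length \<Phi>. v = prod_encode (i, 0)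
      \<or> (\<exists>t\<in>set (terms (\<Phi> ! i)). v = prod_encode (i, Suc (enc_trm t))))" for v
    unfolding tagged by (simp add: tag_var_def apart_def)
  then show ?thesis
    unfolding set_eq_iff by (simp only: UN_iff insert_iff image_iff lessThan_iff Bex_def) blast
qed

text \<open>The valuation of the product query that applies \<open>h\<close> on the \<open>j\<close>-th factor and sends all other
  variables to bottom.\<close>

definition assign :: "(nat \<Rightarrow> nat) \<Rightarrow> nat \<Rightarrow> (nat \<Rightarrow> nat) \<Rightarrow> nat \<Rightarrow> nat" where
  "assign c j h w = (case prod_decode w of (i, m) \<Rightarrow>
     if i \<noteq> j then c 1 else if m = 0 then c 0
     else tval (\<lambda>k. c (Suc (Suc k))) h (inv enc_trm (m - 1)))"

lemma inj_enc_trm: "inj enc_trm"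
  unfolding inj_def by (simp add: enc_trm_eq_iff)

lemma assign_tag: "assign c j h (prod_encode (i, 0)) = (if i = j then c 0 else c 1)"
  unfolding assign_def by simp

lemma assign_apart:
  "assign c j h (prod_encode (i, Suc (enc_trm t)))
     = (if i = j then tval (\<lambda>k. c (Suc (Suc k))) h t else c 1)"
  unfolding assign_def by (simp add: inv_f_f[OF inj_enc_trm])

section \<open>From homomorphisms of the disjuncts to homomorphisms of the product\<close>

lemma ground_part_parts:
  assumes "models F c h (ground_part \<Phi>)"
  shows "models F c h (map (cst_atom top_cst relabel) (terms (concat \<Phi>)))"
    and "models F c h (tagged bot_cst (\<lambda>_. bot_cst) (concat \<Phi>))"
    and "models F c h (selectors (length \<Phi>))"
  using assms unfolding ground_part_def models_append by blast+

lemma set_terms: "set (terms \<phi>) = (\<Union>(R, ts)\<in>set \<phi>. set ts)"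
  unfolding terms_def by auto

text \<open>Factor \<open>j\<close> holds through \<open>h\<close> and the top guards, every other
  factor through the bottom block. The selector row is a separate hypothesis because the ground part
  has no row for \<open>j = 0\<close>.\<close>

lemma assign_models_product_cq:
  assumes G: "models F c h' (ground_part \<Phi>)"
    and sel: "(0, map (\<lambda>i. if i = j then c 0 else c 1) [0..<length \<Phi>]) \<in> F"
    and h: "models (facts_at (c 0) F) (\<lambda>k. c (Suc (Suc k))) h (\<Phi> ! j)"
  shows "models F c (assign c j h) (product_cq \<Phi>)"
  unfolding models_product_cq
proof (intro conjI allI impI)
  show "(0, map (\<lambda>i. assign c j h (prod_encode (i, 0))) [0..<length \<Phi>]) \<in> F"
    unfolding assign_tag by (rule sel)
next
  fix i assume i: "i < length \<Phi>"
  note top = ground_part_parts(1)[OF G, unfolded models_cst_atoms]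
  note bot = ground_part_parts(2)[OF G, unfolded models_tagged models_cst_atoms]
  have atoms: "set (\<Phi> ! i) \<subseteq> set (concat \<Phi>)"
    using nth_mem[OF i] by fastforce
  then have terms: "set (terms (\<Phi> ! i)) \<subseteq> set (terms (concat \<Phi>))"
    unfolding set_terms by blast
  show "models F c (assign c j h) (tagged (tag_var i) (apart i) (\<Phi> ! i))"
  proof (cases "i = j")
    case True
    then show ?thesis
      using h top terms unfolding models_tagged models_cst_atoms
      by (auto simp: models_def facts_at_def tag_var_def apart_def assign_tag assign_apart
          tval_relabel simp del: enc_trm.simps split: trm.splits)
  next
    case False
    then show ?thesis
      using bot nth_mem[OF i] terms unfolding models_tagged models_cst_atoms
      by (fastforce simp: tag_var_def apart_def assign_tag assign_apart
          simp del: enc_trm.simps split: trm.splits)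
  qed
qed

text \<open>The value \<open>h v\<close> can be read off at the copy of \<open>v\<close> in factor
  \<open>j\<close>.\<close>

lemma assign_hom_inject:
  assumes h: "h \<in> homs (\<Phi> ! j) F c'" "h' \<in> homs (\<Phi> ! j) F c'" and j: "j < length \<Phi>"
    and eq: "restrict (assign c j h) (vars (product_cq \<Phi>)) = restrict (assign c j h') (vars (product_cq \<Phi>))"
  shows "h = h'"
proof (rule extensionalityI)
  show "h \<in> extensional (vars (\<Phi> ! j))" "h' \<in> extensional (vars (\<Phi> ! j))"
    using h unfolding homs_def by auto
  fix v assume "v \<in> vars (\<Phi> ! j)"
  then have "Var v \<in> set (terms (\<Phi> ! j))"
    unfolding vars_def terms_def by auto
  then have "prod_encode (j, Suc (enc_trm (Var v))) \<in> vars (product_cq \<Phi>)"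
    unfolding vars_product_cq using j by blast
  then have "assign c j h (prod_encode (j, Suc (enc_trm (Var v))))
      = assign c j h' (prod_encode (j, Suc (enc_trm (Var v))))"
    using eq by (metis restrict_apply')
  then show "h v = h' v" unfolding assign_apart by simp
qed

lemma assign_mem_homs:
  assumes "models F c (assign c j h) (product_cq \<Phi>)"
  shows "restrict (assign c j h) (vars (product_cq \<Phi>)) \<in> homs (product_cq \<Phi>) F c"
  using assms models_cong[of "product_cq \<Phi>" "restrict (assign c j h) (vars (product_cq \<Phi>))" "assign c j h" F c]
  unfolding homs_def by simp

lemma count_small_le_product:
  assumes le: "bag_le [s] \<Psi>" and F: "finite F" and ne: "\<Psi> \<noteq> []"
  shows "cq_count (small_cq s \<Psi>) F c \<le> cq_count (product_cq (s # \<Psi>)) F c"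
proof (cases "models F c undefined (ground_part (s # \<Psi>))")
  case False
  then show ?thesis by (simp add: cq_count_eq_card_homs homs_small_cq)
next
  case G: True
  let ?\<Phi> = "s # \<Psi>"
  let ?F = "facts_at (c 0) F" and ?c = "\<lambda>k. c (Suc (Suc k))"
  let ?P = "homs (product_cq ?\<Phi>) F c"
  let ?H = "\<lambda>j h. restrict (assign c j h) (vars (product_cq ?\<Phi>))"
  have small: "cq_count (small_cq s \<Psi>) F c = card (homs s ?F ?c)"
    using G by (simp add: cq_count_eq_card_homs homs_small_cq)
  have sel: "(0, map (\<lambda>i. if i = j then c 0 else c 1) [0..<length ?\<Phi>]) \<in> F"
    if "0 < j" "j < length ?\<Phi>" for j
    using ground_part_parts(3)[OF G] that unfolding models_selectors by blast
  have mem: "?H j h \<in> ?P" if "h \<in> homs (?\<Phi> ! j) ?F ?c"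
    and "(0, map (\<lambda>i. if i = j then c 0 else c 1) [0..<length ?\<Phi>]) \<in> F" for j h
    using assign_mem_homs[OF assign_models_product_cq[OF G that(2)]] that(1)
    unfolding homs_def by blast
  have "card (homs s ?F ?c) \<le> card ?P"
  proof (cases "c 0 = c 1")
    case True
    \<comment> \<open>With equal tags all selector rows coincide. Row 1, which exists because the
      union is nonempty, thus also serves factor 0, and the homomorphisms of \<open>s\<close> embed
      directly.\<close>
    have "(\<lambda>i. if i = j then c 0 else c 1) = (\<lambda>_. c 0)" for j :: nat
      using True by auto
    moreover have "1 < length ?\<Phi>" using ne by simp
    ultimately have "(0, map (\<lambda>i. if i = 0 then c 0 else c 1) [0..<length ?\<Phi>]) \<in> F"
      using sel[of 1] by (simp only: zero_less_one)
    then have "?H 0 ` homs s ?F ?c \<subseteq> ?P"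
      using mem[of _ 0] by auto
    moreover have "inj_on (?H 0) (homs s ?F ?c)"
      using assign_hom_inject[of _ ?\<Phi> 0 ?F ?c] by (intro inj_onI) simp
    ultimately show ?thesis
      using finite_homs[OF F] card_inj_on_le by blast
  next
    case False
    \<comment> \<open>With distinct tags the homomorphisms of all disjuncts are embedded together;
      disjunct \<open>j\<close> is factor \<open>Suc j\<close>, as factor 0 is
      \<open>s\<close>.\<close>
    let ?S = "SIGMA j:{..<length \<Psi>}. homs (\<Psi> ! j) ?F ?c"
    let ?f = "\<lambda>(j, h). ?H (Suc j) h"
    have "card (homs s ?F ?c) \<le> card ?S"
    proof -
      have "ucq_count [s] ?F ?c \<le> ucq_count \<Psi> ?F ?c"
        using le finite_facts_at[OF F] unfolding bag_le_def by blast
      then show ?thesis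
        unfolding ucq_count_eq_card_Sigma[OF finite_facts_at[OF F], of \<Psi>]
        by (simp add: ucq_count_def cq_count_eq_card_homs)
    qed
    also have "\<dots> \<le> card ?P"
    proof (rule card_inj_on_le[of ?f])
      show "?f ` ?S \<subseteq> ?P"
        using mem sel by (auto simp del: upt_Suc)
      show "finite ?P" by (rule finite_homs[OF F])
      show "inj_on ?f ?S"
      proof (rule inj_onI)
        fix p q assume "p \<in> ?S" "q \<in> ?S" "?f p = ?f q"
        moreover obtain i h j h' where pq: "p = (i, h)" "q = (j, h')"
          by (cases p, cases q)
        ultimately have i: "i \<in> {..<length \<Psi>}" "h \<in> homs (\<Psi> ! i) ?F ?c"
          and j: "j \<in> {..<length \<Psi>}" "h' \<in> homs (\<Psi> ! j) ?F ?c"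
          and eq: "?H (Suc i) h = ?H (Suc j) h'"
          by auto
        \<comment> \<open>The tag variable of factor \<open>Suc i\<close> has the value top only if
          that factor is active, so equal valuations have equal active factors.\<close>
        have "prod_encode (Suc i, 0) \<in> vars (product_cq ?\<Phi>)"
          unfolding vars_product_cq using i by auto
        then have "assign c (Suc i) h (prod_encode (Suc i, 0)) = assign c (Suc j) h' (prod_encode (Suc i, 0))"
          using eq by (metis restrict_apply')
        then have ij: "i = j" using False unfolding assign_tag by (auto split: if_splits)
        moreover have "h = h'"
          using assign_hom_inject[of h ?\<Phi> "Suc i" ?F ?c h' c] i j eq ij by simp
        ultimately show "p = q" unfolding pq by blast
      qed
    qed
    finally show ?thesis .
  qed
  then show ?thesis using small by (simp add: cq_count_eq_card_homs)
qed

section \<open>The canonical structure and the converse inequality\<close>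

definition lift_cst :: "(nat \<Rightarrow> nat) \<Rightarrow> nat \<Rightarrow> nat" where
  "lift_cst c k = (case k of 0 \<Rightarrow> 0 | Suc 0 \<Rightarrow> 1 | Suc (Suc k) \<Rightarrow> c k)"

text \<open>The slice at top is a copy of \<open>F\<close>, and beyond it there are only the facts
  demanded by the ground part. Top is 0 and bottom is 1; these may also be vertices of
  \<open>F\<close>, since tags are recognised by their column.\<close>

definition canonical :: "cq list \<Rightarrow> fact set \<Rightarrow> (nat \<Rightarrow> nat) \<Rightarrow> fact set" where
  "canonical \<Phi> F c = (\<lambda>(R, xs). (2 * R + 2, 0 # xs)) ` F
     \<union> (\<lambda>(R, ts). (R, map (tval (lift_cst c) undefined) ts)) ` set (ground_part \<Phi>)"

lemma lift_cst_simps [simp]: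
  "lift_cst c 0 = 0" "lift_cst c (Suc 0) = 1" "lift_cst c (Suc (Suc k)) = c k"
  unfolding lift_cst_def by auto

lemma finite_canonical: "finite F \<Longrightarrow> finite (canonical \<Phi> F c)"
  unfolding canonical_def by simp

lemma models_canonical_ground: "models (canonical \<Phi> F c) (lift_cst c) undefined (ground_part \<Phi>)"
  unfolding models_def canonical_def by force

text \<open>The inversion facts about \<open>canonical\<close> below all rest on this list, whose
  cases are told apart by relation name, tag and arity.\<close>

lemma canonical_cases:
  assumes "f \<in> canonical \<Phi> F c"
  obtains R xs where "(R, xs) \<in> F" "f = (2 * R + 2, 0 # xs)"
  | R and ts :: "trm list" where "f = (2 * R + 2, 1 # map (\<lambda>_. 1) ts)"
  | k where "f = (2 * k + 1, [0, c k])"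
  | k where "f = (2 * k + 1, [1, 1])"
  | "f = (0, [])"
  | j where "0 < j" "j < length \<Phi>" "f = (0, map (\<lambda>i. if i = j then 0 else 1) [0..<length \<Phi>])"
proof -
  note cs = that
  consider "f \<in> (\<lambda>(R, xs). (2 * R + 2, 0 # xs)) ` F"
    | a where "a \<in> set (ground_part \<Phi>)" "f = (fst a, map (tval (lift_cst c) undefined) (snd a))"
    using assms unfolding canonical_def by (auto simp: case_prod_beta)
  then show thesis
  proof cases
    case 1
    then show thesis using cs(1) by auto
  next
    case 2
    then consider "a \<in> set (map (cst_atom top_cst relabel) (terms (concat \<Phi>)))"
      | "a \<in> set (tag_atoms bot_cst (\<lambda>_. bot_cst) (concat \<Phi>))"
      | "a \<in> set (map (cst_atom bot_cst (\<lambda>_. bot_cst)) (terms (concat \<Phi>)))"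
      | "a \<in> set (selectors (length \<Phi>))"
      unfolding ground_part_def tagged_def set_append by blast
    then show thesis
    proof cases
      case 1
      then obtain t where "a = cst_atom top_cst relabel t" by auto
      with 2 cs(3,5) show thesis by (cases t) auto
    next
      case 2
      then obtain r :: atom where "a = (2 * fst r + 2, bot_cst # map (\<lambda>_. bot_cst) (snd r))"
        unfolding tag_atoms_def set_map case_prod_beta by (rule imageE) blast
      with \<open>f = _\<close> cs(2)[of "fst r" "snd r"] show thesis by (simp add: o_def)
    next
      case 3
      then obtain t where "a = cst_atom bot_cst (\<lambda>_. bot_cst) t" by auto
      with 2 cs(4,5) show thesis by (cases t) auto
    next
      case 4
      then obtain j where j: "j \<in> set [1..<length \<Phi>]"
        and a: "a = (0, map (\<lambda>i. if i = j then top_cst else bot_cst) [0..<length \<Phi>])"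
        unfolding selectors_def by auto
      have "0 < j" "j < length \<Phi>"
        using j by auto
      with a \<open>f = _\<close> cs(6)[of j] show thesis
        by (simp add: o_def if_distrib[of "tval _ _"] cong: if_cong)
    qed
  qed
qed

lemma facts_at_canonical: "facts_at 0 (canonical \<Phi> F c) = F"
proof -
  have "(R, xs) \<in> F" if "(2 * R + 2, 0 # xs) \<in> canonical \<Phi> F c" for R xs
    using that
  proof (cases rule: canonical_cases)
    case (3 k)
    \<comment> \<open>Tagged copies have even names, guards odd ones.\<close>
    then have "2 * R + 2 = 2 * k + 1" by simp
    then have False by presburger
    then show ?thesis ..
  qed auto
  moreover have "(2 * R + 2, 0 # xs) \<in> canonical \<Phi> F c" if "(R, xs) \<in> F" for R xs
    using that unfolding canonical_def by force
  ultimately show ?thesis unfolding facts_at_def by auto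
qed

lemma canonical_bot:
  assumes "(2 * R + 2, 1 # xs) \<in> canonical \<Phi> F c" "x \<in> set xs"
  shows "x = 1"
  using assms(1)
proof (cases rule: canonical_cases)
  case (3 k)
  then show ?thesis by simp
qed (use assms(2) in auto)

lemma canonical_cst:
  assumes "(2 * k + 1, [0, x]) \<in> canonical \<Phi> F c"
  shows "x = c k"
  using assms
proof (cases rule: canonical_cases)
  case (1 R xs)
  then have "2 * k + 1 = 2 * R + 2" by simp
  then show ?thesis by presburger
qed auto

lemma canonical_selector:
  assumes "(0, x # xs) \<in> canonical \<Phi> F c"
  obtains j where "0 < j" "j < length \<Phi>"
    "x # xs = map (\<lambda>i. if i = j then 0 else 1) [0..<length \<Phi>]"
  using assms by (cases rule: canonical_cases) auto

text \<open>Every homomorphism of the product into the canonical structure comes from an active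
  disjunct and a homomorphism of it into \<open>F\<close>, so the disjoint union maps onto
  them.\<close>

lemma count_product_canonical_le:
  assumes F: "finite F"
  shows "cq_count (product_cq (s # \<Psi>)) (canonical (s # \<Psi>) F c) (lift_cst c) \<le> ucq_count \<Psi> F c"
proof -
  let ?\<Phi> = "s # \<Psi>"
  let ?C = "canonical ?\<Phi> F c"
  let ?P = "homs (product_cq ?\<Phi>) ?C (lift_cst c)"
  let ?S = "SIGMA j:{..<length \<Psi>}. homs (\<Psi> ! j) F c"
  let ?f = "\<lambda>(j, h). restrict (assign (lift_cst c) (Suc j) h) (vars (product_cq ?\<Phi>))"
  have "?P \<subseteq> ?f ` ?S"
  proof
    fix H assume H: "H \<in> ?P"
    then have ext: "H \<in> extensional (vars (product_cq ?\<Phi>))"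
      and sel: "(0, map (\<lambda>i. H (prod_encode (i, 0))) [0..<length ?\<Phi>]) \<in> ?C"
      and tag: "\<And>i. i < length ?\<Phi> \<Longrightarrow> models ?C (lift_cst c) H (tagged (tag_var i) (apart i) (?\<Phi> ! i))"
      unfolding homs_def models_product_cq by auto
    have "map (\<lambda>i. H (prod_encode (i, 0))) [0..<length ?\<Phi>] \<noteq> []" by simp
    then obtain x xs where xs: "map (\<lambda>i. H (prod_encode (i, 0))) [0..<length ?\<Phi>] = x # xs"
      by (meson neq_Nil_conv)
    \<comment> \<open>The nonempty facts named 0 are the selector rows, so exactly one factor
      \<open>j\<close> is active, and \<open>0 < j\<close> excludes \<open>s\<close>.\<close>
    obtain j where j: "0 < j" "j < length ?\<Phi>"
      and "map (\<lambda>i. H (prod_encode (i, 0))) [0..<length ?\<Phi>] = map (\<lambda>i. if i = j then 0 else 1) [0..<length ?\<Phi>]"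
      using sel unfolding xs by (rule canonical_selector)
    then have Htag: "H (prod_encode (i, 0)) = (if i = j then 0 else 1)" if "i < length ?\<Phi>" for i
      using that by (simp del: upt_Suc)
    have atom: "(2 * R + 2, H (prod_encode (i, 0)) # map (\<lambda>t. H (prod_encode (i, Suc (enc_trm t)))) ts) \<in> ?C"
      if "i < length ?\<Phi>" "(R, ts) \<in> set (?\<Phi> ! i)" for i R ts
      using tag[OF that(1)] that(2) unfolding models_tagged by (auto simp: tag_var_def apart_def)
    \<comment> \<open>Each term of an inactive factor occurs in an atom tagged by 1, and such facts
      have only entries 1.\<close>
    have bot: "H (prod_encode (i, Suc (enc_trm t))) = 1"
      if i: "i < length ?\<Phi>" "i \<noteq> j" and t: "t \<in> set (terms (?\<Phi> ! i))" for i t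
    proof -
      obtain R ts where "(R, ts) \<in> set (?\<Phi> ! i)" "t \<in> set ts"
        using t unfolding set_terms by auto
      then show ?thesis
        using canonical_bot[of R] atom[of i R ts] i Htag[of i] by auto
    qed
    \<comment> \<open>Under the tag 0, the guard of \<open>k\<close> contains no value but
      \<open>c k\<close>; this restores the constants that \<open>apart\<close> turned into
      variables.\<close>
    have cst: "H (prod_encode (j, Suc (enc_trm (Cst k)))) = c k" if "Cst k \<in> set (terms (?\<Phi> ! j))" for k
    proof -
      have "(2 * k + 1, [0, H (prod_encode (j, Suc (enc_trm (Cst k))))]) \<in> ?C"
        using bspec[OF conjunct2[OF tag[OF j(2), unfolded models_tagged models_cst_atoms]] that] Htag[OF j(2)]
        by (simp add: tag_var_def apart_def)
      then show ?thesis by (rule canonical_cst)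
    qed
    define h where "h = restrict (\<lambda>v. H (prod_encode (j, Suc (enc_trm (Var v))))) (vars (?\<Phi> ! j))"
    have val: "H (prod_encode (j, Suc (enc_trm t))) = tval c h t" if "t \<in> set (terms (?\<Phi> ! j))" for t
    proof (cases t)
      case (Var v)
      then have "v \<in> vars (?\<Phi> ! j)" using that unfolding vars_def set_terms by force
      then show ?thesis using Var by (simp add: h_def)
    next
      case (Cst k)
      then show ?thesis using cst that by simp
    qed
    have "(R, map (tval c h) ts) \<in> F" if a: "(R, ts) \<in> set (?\<Phi> ! j)" for R ts
    proof -
      have "map (\<lambda>t. H (prod_encode (j, Suc (enc_trm t)))) ts = map (tval c h) ts"
        using val a unfolding set_terms by auto
      then have "(2 * R + 2, 0 # map (tval c h) ts) \<in> ?C"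
        using atom[OF j(2) a] Htag[OF j(2)] by (simp del: map_eq_conv)
      then have "(R, map (tval c h) ts) \<in> facts_at 0 ?C"
        unfolding facts_at_def by simp
      then show ?thesis unfolding facts_at_canonical .
    qed
    moreover have "h \<in> extensional (vars (?\<Phi> ! j))" by (simp add: h_def)
    ultimately have h: "h \<in> homs (?\<Phi> ! j) F c"
      unfolding homs_def models_def by auto
    have "H = restrict (assign (lift_cst c) j h) (vars (product_cq ?\<Phi>))"
    proof (rule extensionalityI[OF ext])
      fix w assume w: "w \<in> vars (product_cq ?\<Phi>)"
      then consider i where "i < length ?\<Phi>" "w = prod_encode (i, 0)"
        | i t where "i < length ?\<Phi>" "t \<in> set (terms (?\<Phi> ! i))" "w = prod_encode (i, Suc (enc_trm t))"
        unfolding vars_product_cq by blast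
      then have "H w = assign (lift_cst c) j h w"
      proof cases
        case 1
        then show ?thesis by (simp add: assign_tag Htag)
      next
        case (2 i t)
        then show ?thesis
          using bot[of i t] val[of t] by (cases "i = j") (simp_all add: assign_apart)
      qed
      then show "H w = restrict (assign (lift_cst c) j h) (vars (product_cq ?\<Phi>)) w"
        using w by simp
    qed simp
    \<comment> \<open>Factor \<open>j\<close> of the product is disjunct \<open>j - 1\<close> of the
      union.\<close>
    moreover obtain j' where "j = Suc j'" using j by (cases j) auto
    ultimately show "H \<in> ?f ` ?S"
      using h j by (intro image_eqI[of _ _ "(j', h)"]) auto
  qed
  moreover have "finite ?S" by (simp add: finite_homs[OF F])
  ultimately have "card ?P \<le> card ?S" by (rule surj_card_le[rotated])
  then show ?thesis
    unfolding cq_count_eq_card_homs ucq_count_eq_card_Sigma[OF F] .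
qed

lemma count_small_canonical:
  "cq_count (small_cq s \<Psi>) (canonical (s # \<Psi>) F c) (lift_cst c) = cq_count s F c"
  by (simp add: cq_count_eq_card_homs homs_small_cq models_canonical_ground facts_at_canonical)

text \<open>From left to right the inequality is tested on canonical structures, where the small
  query counts \<open>s\<close> exactly and the product counts at most the union.\<close>

lemma bag_le_iff_product:
  assumes "\<Psi> \<noteq> []"
  shows "bag_le [small_cq s \<Psi>] [product_cq (s # \<Psi>)] \<longleftrightarrow> bag_le [s] \<Psi>"
proof
  assume le: "bag_le [small_cq s \<Psi>] [product_cq (s # \<Psi>)]"
  show "bag_le [s] \<Psi>"
    unfolding bag_le_def
  proof (intro allI impI)
    fix F :: "fact set" and c :: "nat \<Rightarrow> nat" assume F: "finite F"
    have "ucq_count [small_cq s \<Psi>] (canonical (s # \<Psi>) F c) (lift_cst c)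
        \<le> ucq_count [product_cq (s # \<Psi>)] (canonical (s # \<Psi>) F c) (lift_cst c)"
      using le finite_canonical[OF F] unfolding bag_le_def by blast
    then have "cq_count s F c \<le> cq_count (product_cq (s # \<Psi>)) (canonical (s # \<Psi>) F c) (lift_cst c)"
      by (simp add: ucq_count_def count_small_canonical)
    also have "\<dots> \<le> ucq_count \<Psi> F c" by (rule count_product_canonical_le[OF F])
    finally show "ucq_count [s] F c \<le> ucq_count \<Psi> F c" by (simp add: ucq_count_def)
  qed
next
  assume "bag_le [s] \<Psi>"
  then show "bag_le [small_cq s \<Psi>] [product_cq (s # \<Psi>)]"
    using count_small_le_product[OF _ _ assms]
    unfolding bag_le_def[of "[small_cq s \<Psi>]"] by (simp add: ucq_count_def)
qed

subsection \<open>Computability of the translation\<close>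

abbreviation map_code :: "(nat \<Rightarrow> nat) \<Rightarrow> nat \<Rightarrow> nat" where
  "map_code g l \<equiv> list_encode (map g (list_decode l))"

abbreviation append_code :: "nat \<Rightarrow> nat \<Rightarrow> nat" where
  "append_code k l \<equiv> list_encode (list_decode k @ list_decode l)"

abbreviation concat_code :: "nat \<Rightarrow> nat" where
  "concat_code l \<equiv> list_encode (concat (map list_decode (list_decode l)))"

definition tag_atoms_code :: "nat \<Rightarrow> (nat \<Rightarrow> nat) \<Rightarrow> nat \<Rightarrow> nat" where
  "tag_atoms_code y \<tau> \<phi> =
     map_code (\<lambda>a. pair (Suc (Suc (2 * pi1 a))) (cons y (map_code \<tau> (pi2 a)))) \<phi>"

text \<open>Even codes are variables. The code of \<open>Cst k\<close> is \<open>2 * k + 1\<close>,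
  which is also the name of its guard, so \<open>t\<close> itself appears as relation name.\<close>

definition cst_atom_code :: "nat \<Rightarrow> (nat \<Rightarrow> nat) \<Rightarrow> nat \<Rightarrow> nat" where
  "cst_atom_code y \<tau> t = (if t mod 2 = 0 then pair 0 0 else pair t (cons y (cons (\<tau> t) 0)))"

definition terms_code :: "nat \<Rightarrow> nat" where
  "terms_code \<phi> = concat_code (map_code pi2 \<phi>)"

definition tagged_code :: "nat \<Rightarrow> (nat \<Rightarrow> nat) \<Rightarrow> nat \<Rightarrow> nat" where
  "tagged_code y \<tau> \<phi> =
     append_code (tag_atoms_code y \<tau> \<phi>) (map_code (cst_atom_code y \<tau>) (terms_code \<phi>))"

definition relabel_code :: "nat \<Rightarrow> nat" where
  "relabel_code t = (if t mod 2 = 0 then t else t + 4)"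

text \<open>The codes of top and bottom are 1 and 3. The outer map runs over the tail of the list of
  numbers below \<open>n\<close>, which leaves out row 0.\<close>

definition selectors_code :: "nat \<Rightarrow> nat" where
  "selectors_code n = map_code
     (\<lambda>j. pair 0 (map_code (\<lambda>i. if i = j then 1 else 3) (list_encode [0..<n])))
     (pi2 (list_encode [0..<n] - 1))"

definition ground_code :: "nat \<Rightarrow> nat" where
  "ground_code \<Phi> =
     append_code (map_code (cst_atom_code 1 relabel_code) (terms_code (concat_code \<Phi>)))
       (append_code (tagged_code 3 (\<lambda>_. 3) (concat_code \<Phi>))
         (selectors_code (length (list_decode \<Phi>))))"

definition small_code :: "nat \<Rightarrow> nat \<Rightarrow> nat" where
  "small_code s \<Psi> = append_code (tag_atoms_code 1 relabel_code s) (ground_code (cons s \<Psi>))"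

definition product_code :: "nat \<Rightarrow> nat" where
  "product_code \<Phi> = cons
     (pair 0 (map_code (\<lambda>i. 2 * pair i 0) (list_encode [0..<length (list_decode \<Phi>)])))
     (concat_code (map_code
       (\<lambda>j. tagged_code (2 * pair j 0) (\<lambda>t. 2 * pair j (Suc t)) (nth_code \<Phi> j))
       (list_encode [0..<length (list_decode \<Phi>)])))"

section \<open>Computability of the functions on codes\<close>

lemmas computable_intros =
  computable_id computable_const computable_Suc computable_pair computable_fst computable_snd
  computable_double computable_add computable_diff computable_mod2 computable_if_eq
  computable_append computable_concat computable_length computable_upt computable_nth_code

lemma computable2_const: "computable f \<Longrightarrow> computable2 (\<lambda>x y. f y)"
  unfolding computable2_def by (rule computable_compose[OF _ computable_pi2])

lemma computable_tag_atoms_code: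
  assumes "computable y" "computable2 \<tau>" "computable \<phi>"
  shows "computable (\<lambda>x. tag_atoms_code (y x) (\<tau> x) (\<phi> x))"
  unfolding tag_atoms_code_def
proof (rule computable_map[OF _ assms(3)])
  show "computable2 (\<lambda>x a. pair (Suc (Suc (2 * pi1 a))) (cons (y x) (map_code (\<tau> x) (pi2 a))))"
    unfolding computable2_def
    by (intro computable_intros computable_compose[OF assms(1)] computable_map
        computable2_compose_left[OF assms(2)])
qed

lemma computable_cst_atom_code:
  assumes "computable y" "computable2 \<tau>" "computable t"
  shows "computable (\<lambda>x. cst_atom_code (y x) (\<tau> x) (t x))"
  unfolding cst_atom_code_def
  by (intro computable_intros assms computable2_compose[OF assms(2)])

lemma computable_terms_code:
  assumes "computable \<phi>"
  shows "computable (\<lambda>x. terms_code (\<phi> x))"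
  unfolding terms_code_def
  by (intro computable_intros computable_map computable2_const assms)

lemma computable_map_cst_atom_code:
  assumes "computable y" "computable2 \<tau>" "computable ts"
  shows "computable (\<lambda>x. map_code (cst_atom_code (y x) (\<tau> x)) (ts x))"
proof (rule computable_map[OF _ assms(3)])
  show "computable2 (\<lambda>x. cst_atom_code (y x) (\<tau> x))"
    unfolding computable2_def
    by (intro computable_intros computable_cst_atom_code computable_compose[OF assms(1)]
        computable2_compose_left[OF assms(2)])
qed

lemma computable_tagged_code:
  assumes "computable y" "computable2 \<tau>" "computable \<phi>"
  shows "computable (\<lambda>x. tagged_code (y x) (\<tau> x) (\<phi> x))"
  unfolding tagged_code_def
  by (intro computable_intros computable_tag_atoms_code computable_map_cst_atom_code
      computable_terms_code assms)

lemma computable_relabel_code: "computable relabel_code"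
  unfolding relabel_code_def by (intro computable_intros)

lemma computable_selectors_code:
  assumes "computable n"
  shows "computable (\<lambda>x. selectors_code (n x))"
  unfolding selectors_code_def
proof (rule computable_map)
  show "computable2 (\<lambda>x j. pair 0 (map_code (\<lambda>i. if i = j then 1 else 3) (list_encode [0..<n x])))"
    unfolding computable2_def
  proof (intro computable_pair computable_const computable_map)
    show "computable2 (\<lambda>p i. if i = pi2 p then 1 else 3)"
      unfolding computable2_def by (intro computable_intros)
  qed (intro computable_upt computable_compose[OF assms] computable_pi1)
qed (intro computable_intros assms)

lemma computable_ground_code:
  assumes "computable \<Phi>"
  shows "computable (\<lambda>x. ground_code (\<Phi> x))"
  unfolding ground_code_def
  by (intro computable_intros computable_map_cst_atom_code computable_terms_code
      computable_tagged_code computable_selectors_code computable2_const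
      computable_relabel_code assms)

lemma computable_small_code:
  assumes "computable s" "computable \<Psi>"
  shows "computable (\<lambda>x. small_code (s x) (\<Psi> x))"
  unfolding small_code_def
  by (intro computable_intros computable_tag_atoms_code computable_ground_code computable2_const
      computable_relabel_code assms)

lemma computable_product_code:
  assumes "computable \<Phi>"
  shows "computable (\<lambda>x. product_code (\<Phi> x))"
proof -
  have "computable2 (\<lambda>x j. tagged_code (2 * pair j 0) (\<lambda>t. 2 * pair j (Suc t)) (nth_code (\<Phi> x) j))"
    unfolding computable2_def
  proof (intro computable_tagged_code)
    show "computable2 (\<lambda>p t. 2 * pair (pi2 p) (Suc t))"
      unfolding computable2_def by (intro computable_intros)
  qed (intro computable_intros computable_compose[OF assms])+
  moreover have "computable (\<lambda>i. 2 * pair i 0)"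
    by (intro computable_intros)
  ultimately show ?thesis
    unfolding product_code_def
    by (intro computable_intros computable_map computable2_const assms)
qed

section \<open>Agreement of the code functions with the queries\<close>

lemma prod_decode_enc_atom: "prod_decode (enc_atom a) = (fst a, list_encode (map enc_trm (snd a)))"
  unfolding enc_atom_def by simp

lemma list_decode_enc_cq: "list_decode (enc_cq \<phi>) = map enc_atom \<phi>"
  unfolding enc_cq_def by simp

lemma enc_cq_append: "enc_cq (\<phi> @ \<psi>) = append_code (enc_cq \<phi>) (enc_cq \<psi>)"
  unfolding enc_cq_def by simp

lemma enc_cq_concat: "enc_cq (concat \<Phi>) = concat_code (enc_ucq \<Phi>)"
  unfolding enc_ucq_def enc_cq_def by (simp add: map_concat o_def)

text \<open>Here \<open>\<tau>'\<close> is the effect of \<open>\<tau>\<close> on codes of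
  terms.\<close>

lemma enc_tag_atoms:
  assumes "enc_trm \<circ> \<tau> = \<tau>' \<circ> enc_trm"
  shows "enc_cq (tag_atoms y \<tau> \<phi>) = tag_atoms_code (enc_trm y) \<tau>' (enc_cq \<phi>)"
proof -
  have enc: "enc_trm (\<tau> t) = \<tau>' (enc_trm t)" for t
    using fun_cong[OF assms, of t] by simp
  have "enc_cq (tag_atoms y \<tau> \<phi>) = list_encode (map (\<lambda>a. enc_atom (2 * fst a + 2, y # map \<tau> (snd a))) \<phi>)"
    unfolding enc_cq_def tag_atoms_def by (simp add: o_def case_prod_beta)
  then show ?thesis
    unfolding tag_atoms_code_def list_decode_enc_cq
    by (simp add: o_def prod_decode_enc_atom) (simp add: enc_atom_def o_def enc)
qed

lemma enc_cst_atom: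
  assumes "enc_trm \<circ> \<tau> = \<tau>' \<circ> enc_trm"
  shows "enc_atom (cst_atom y \<tau> t) = cst_atom_code (enc_trm y) \<tau>' (enc_trm t)"
  using fun_cong[OF assms, of t] unfolding cst_atom_code_def enc_atom_def by (cases t) auto

lemma enc_terms: "list_encode (map enc_trm (terms \<phi>)) = terms_code (enc_cq \<phi>)"
  unfolding terms_code_def list_decode_enc_cq terms_def
  by (simp add: map_concat o_def prod_decode_enc_atom)

lemma enc_map_cst_atom:
  assumes "enc_trm \<circ> \<tau> = \<tau>' \<circ> enc_trm"
  shows "enc_cq (map (cst_atom y \<tau>) (terms \<phi>))
    = map_code (cst_atom_code (enc_trm y) \<tau>') (terms_code (enc_cq \<phi>))"
  unfolding enc_terms[symmetric] enc_cq_def[of "map _ _"]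
  by (simp add: o_def enc_cst_atom[OF assms])

lemma enc_tagged:
  assumes "enc_trm \<circ> \<tau> = \<tau>' \<circ> enc_trm"
  shows "enc_cq (tagged y \<tau> \<phi>) = tagged_code (enc_trm y) \<tau>' (enc_cq \<phi>)"
  unfolding tagged_def tagged_code_def enc_cq_append
    enc_tag_atoms[OF assms] enc_map_cst_atom[OF assms] ..

lemma enc_relabel: "enc_trm \<circ> relabel = relabel_code \<circ> enc_trm"
proof
  show "(enc_trm \<circ> relabel) t = (relabel_code \<circ> enc_trm) t" for t
    unfolding relabel_code_def by (cases t) auto
qed

lemma enc_selectors: "enc_cq (selectors n) = selectors_code n"
proof -
  have "pi2 (list_encode [0..<n] - 1) = list_encode [1..<n]"
  \<comment> \<open>For \<open>n = 0\<close> truncated subtraction leaves 0, and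
    \<open>prod_decode 0 = (0, 0)\<close> again yields the code of the empty list.\<close>
  proof (cases "n = 0")
    case False
    then have "[0..<n] = 0 # [1..<n]" by (simp add: upt_conv_Cons)
    then show ?thesis by (simp del: upt_Suc)
  qed (simp add: prod_decode_def prod_decode_aux.simps)
  then show ?thesis
    unfolding selectors_code_def selectors_def enc_cq_def enc_atom_def
    by (simp add: o_def if_distrib[of enc_trm] cong: if_cong)
qed

lemma enc_ground_part: "enc_cq (ground_part \<Phi>) = ground_code (enc_ucq \<Phi>)"
proof -
  have bot: "enc_trm \<circ> (\<lambda>_. bot_cst) = (\<lambda>_. 3) \<circ> enc_trm"
    by (simp add: fun_eq_iff)
  have "length (list_decode (enc_ucq \<Phi>)) = length \<Phi>"
    unfolding enc_ucq_def by simp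
  then show ?thesis
    unfolding ground_part_def ground_code_def enc_cq_append enc_map_cst_atom[OF enc_relabel]
      enc_tagged[OF bot] enc_selectors enc_cq_concat
    by simp
qed

lemma enc_small_cq: "enc_cq (small_cq s \<Psi>) = small_code (enc_cq s) (enc_ucq \<Psi>)"
  unfolding small_cq_def small_code_def enc_cq_append enc_tag_atoms[OF enc_relabel] enc_ground_part
  by (simp add: enc_ucq_def)

lemma enc_product_cq: "enc_cq (product_cq \<Phi>) = product_code (enc_ucq \<Phi>)"
proof -
  let ?ns = "[0..<length \<Phi>]"
  have len: "length (list_decode (enc_ucq \<Phi>)) = length \<Phi>"
    unfolding enc_ucq_def by simp
  \<comment> \<open>\<open>nth_code\<close> is known only for valid positions, so the two functions
    are compared below the length and only then mapped over the index list.\<close>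
  have "enc_cq (tagged (tag_var j) (apart j) (\<Phi> ! j))
      = tagged_code (2 * pair j 0) (\<lambda>t. 2 * pair j (Suc t)) (nth_code (enc_ucq \<Phi>) j)"
    if "j < length \<Phi>" for j
    using that enc_tagged[of "apart j" "\<lambda>t. 2 * pair j (Suc t)" "tag_var j" "\<Phi> ! j"]
    by (simp add: apart_def tag_var_def enc_ucq_def nth_code fun_eq_iff)
  then have "map (\<lambda>j. enc_cq (tagged (tag_var j) (apart j) (\<Phi> ! j))) ?ns
      = map (\<lambda>j. tagged_code (2 * pair j 0) (\<lambda>t. 2 * pair j (Suc t)) (nth_code (enc_ucq \<Phi>) j)) ?ns"
    by simp
  then have "enc_ucq (map (\<lambda>j. tagged (tag_var j) (apart j) (\<Phi> ! j)) ?ns)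
      = map_code (\<lambda>j. tagged_code (2 * pair j 0) (\<lambda>t. 2 * pair j (Suc t)) (nth_code (enc_ucq \<Phi>) j))
          (list_encode ?ns)"
    unfolding enc_ucq_def[of "map _ _"] by (simp add: o_def del: map_eq_conv)
  moreover have "enc_atom (0, map tag_var ?ns) = pair 0 (map_code (\<lambda>i. 2 * pair i 0) (list_encode ?ns))"
    unfolding enc_atom_def by (simp add: o_def tag_var_def)
  moreover have "enc_cq (a # \<phi>) = cons (enc_atom a) (enc_cq \<phi>)" for a \<phi>
    unfolding enc_cq_def by simp
  ultimately show ?thesis
    unfolding product_cq_def product_code_def len by (simp only: enc_cq_concat)
qed

section \<open>The two reductions\<close>

theorem theorem1:
  shows "decidable_on UNIV enc_cq_cq QCP_CQ \<longleftrightarrow>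
         decidable_on {p. snd p \<noteq> []} enc_cq_ucq QCP_CQ_UCQ"
proof
  assume dec: "decidable_on UNIV enc_cq_cq QCP_CQ"
  show "decidable_on {p. snd p \<noteq> []} enc_cq_ucq QCP_CQ_UCQ"
  proof (rule decidable_on_reduce[OF dec])
    show "computable (\<lambda>x. pair (small_code (pi1 x) (pi2 x)) (product_code (cons (pi1 x) (pi2 x))))"
      by (intro computable_intros computable_small_code computable_product_code)
    show "(small_cq (fst p) (snd p), product_cq (fst p # snd p)) \<in> UNIV \<and>
        enc_cq_cq (small_cq (fst p) (snd p), product_cq (fst p # snd p))
          = pair (small_code (pi1 (enc_cq_ucq p)) (pi2 (enc_cq_ucq p)))
              (product_code (cons (pi1 (enc_cq_ucq p)) (pi2 (enc_cq_ucq p))))" for p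
      by (simp add: enc_cq_cq_def enc_cq_ucq_def enc_small_cq enc_product_cq enc_ucq_def)
    show "QCP_CQ (small_cq (fst p) (snd p), product_cq (fst p # snd p)) \<longleftrightarrow> QCP_CQ_UCQ p"
      if "p \<in> {p. snd p \<noteq> []}" for p
      using that by (simp add: QCP_CQ_def QCP_CQ_UCQ_def bag_le_iff_product)
  qed
next
  assume dec: "decidable_on {p. snd p \<noteq> []} enc_cq_ucq QCP_CQ_UCQ"
  show "decidable_on UNIV enc_cq_cq QCP_CQ"
  proof (rule decidable_on_reduce[OF dec])
    \<comment> \<open>A single query is a union with one disjunct; \<open>cons y 0\<close> codes a
      one-element list.\<close>
    show "computable (\<lambda>x. pair (pi1 x) (cons (pi2 x) 0))"
      by (intro computable_intros)
    show "(fst p, [snd p]) \<in> {p. snd p \<noteq> []} \<and>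
        enc_cq_ucq (fst p, [snd p]) = pair (pi1 (enc_cq_cq p)) (cons (pi2 (enc_cq_cq p)) 0)" for p
      by (simp add: enc_cq_ucq_def enc_cq_cq_def enc_ucq_def)
    show "QCP_CQ_UCQ (fst p, [snd p]) \<longleftrightarrow> QCP_CQ p" for p
      by (simp add: QCP_CQ_def QCP_CQ_UCQ_def)
  qed
qed

end
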